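(* Let $A, B, C$ be a right regular triple of semigroups. If $A$ is right simple, then $C$ is also right simple.
   Context: A semigroup is a nonempty set with an associative multiplication. For a semigroup $S$, a nonempty set $\Lambda$ and a mapping $P:\Lambda\to S$, let $\mathcal{M}(S;\Lambda;P)$ denote the semigroup on the set $S\times\Lambda$ with multiplication $(s,\lambda)(t,\mu)=(sP(\lambda)t,\mu)$ (a Rees matrix semigroup without zero with singleton first index set). For a semigroup $S$, $\theta_S=\{(a,b)\in S\times S: xa=xb \text{ for all } x\in S\}$; this is a congruence on $S$ (the kernel of the right regular representation of $S$). A triple $A,B,C$ of semigroups is called right regular if there exist mappings (not necessarily homomorphisms) $P:B\to A$ and $P':B\to C$ such that $\mathcal{M}(A;B;P)/\theta_{\mathcal{M}(A;B;P)}\cong\mathcal{M}(C;B;P')$ as semigroups. A semigroup $S$ is right simple if $S$ is its only right ideal (a right ideal is a nonempty subset $R\subseteq S$ with $RS\subseteq R$); equivalently, $aS=S$ for every $a\in S$. *)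

theory Defs
  imports "HOL-Algebra.Congruence" "HOL-Library.FuncSet"
begin

text \<open>
  The monoid record of HOL-Algebra carries a unit; semigroups here have none, so the underlying
  structure is a bare carrier with a multiplication.
\<close>

record 'a magma = "'a partial_object" +
  mult :: "['a, 'a] \<Rightarrow> 'a"  (infixl \<open>\<odot>\<index>\<close> 70)

locale carrier_semigroup =
  fixes S (structure)
  assumes carrier_nonempty: "carrier S \<noteq> {}"
    and mult_closed [simp, intro]:
      "\<lbrakk>x \<in> carrier S; y \<in> carrier S\<rbrakk> \<Longrightarrow> x \<odot> y \<in> carrier S"
    and mult_assoc:
      "\<lbrakk>x \<in> carrier S; y \<in> carrier S; z \<in> carrier S\<rbrakk> \<Longrightarrow> (x \<odot> y) \<odot> z = x \<odot> (y \<odot> z)"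

definition semigroup_hom :: "('a, 'm) magma_scheme \<Rightarrow> ('b, 'n) magma_scheme \<Rightarrow> ('a \<Rightarrow> 'b) set" where
  "semigroup_hom S T =
    {h \<in> carrier S \<rightarrow> carrier T.
      \<forall>x\<in>carrier S. \<forall>y\<in>carrier S. h (x \<odot>\<^bsub>S\<^esub> y) = h x \<odot>\<^bsub>T\<^esub> h y}"

definition semigroup_iso :: "('a, 'm) magma_scheme \<Rightarrow> ('b, 'n) magma_scheme \<Rightarrow> bool"
    (infix \<open>\<cong>\<close> 60) where
  "S \<cong> T \<longleftrightarrow> (\<exists>h \<in> semigroup_hom S T. bij_betw h (carrier S) (carrier T))"

definition right_ideal :: "'a set \<Rightarrow> ('a, 'm) magma_scheme \<Rightarrow> bool" where
  "right_ideal R S \<longleftrightarrow>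
    R \<noteq> {} \<and> R \<subseteq> carrier S \<and> (\<forall>r\<in>R. \<forall>s\<in>carrier S. r \<odot>\<^bsub>S\<^esub> s \<in> R)"

definition right_simple :: "('a, 'm) magma_scheme \<Rightarrow> bool" where
  "right_simple S \<longleftrightarrow> (\<forall>R. right_ideal R S \<longrightarrow> R = carrier S)"

definition rees_matrix ::
    "('a, 'm) magma_scheme \<Rightarrow> 'l set \<Rightarrow> ('l \<Rightarrow> 'a) \<Rightarrow> ('a \<times> 'l) magma" where
  "rees_matrix S \<Lambda> P =
    \<lparr>carrier = carrier S \<times> \<Lambda>,
     mult = (\<lambda>(s, l) (t, m). (s \<odot>\<^bsub>S\<^esub> P l \<odot>\<^bsub>S\<^esub> t, m))\<rparr>"

definition theta :: "('a, 'm) magma_scheme \<Rightarrow> ('a \<times> 'a) set" where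
  "theta S =
    {(a, b) \<in> carrier S \<times> carrier S. \<forall>x\<in>carrier S. x \<odot>\<^bsub>S\<^esub> a = x \<odot>\<^bsub>S\<^esub> b}"

definition is_congruence :: "('a, 'm) magma_scheme \<Rightarrow> ('a \<times> 'a) set \<Rightarrow> bool" where
  "is_congruence S r \<longleftrightarrow> equiv (carrier S) r \<and>
    (\<forall>(a, b)\<in>r. \<forall>(c, d)\<in>r. (a \<odot>\<^bsub>S\<^esub> c, b \<odot>\<^bsub>S\<^esub> d) \<in> r)"

text \<open>
  For a congruence, the union in the multiplication is over equal classes; see
  \<open>quotient_semigroup_mult\<close> below.
\<close>

definition quotient_semigroup :: "('a, 'm) magma_scheme \<Rightarrow> ('a \<times> 'a) set \<Rightarrow> 'a set magma" where
  "quotient_semigroup S r =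
    \<lparr>carrier = carrier S // r,
     mult = (\<lambda>X Y. \<Union>x\<in>X. \<Union>y\<in>Y. r `` {x \<odot>\<^bsub>S\<^esub> y})\<rparr>"

text \<open>
  Only the underlying set of \<open>B\<close> enters, as index set; the maps \<open>P\<close> and \<open>P'\<close> need not be
  homomorphisms.
\<close>

definition right_regular_triple ::
    "('a, 'm) magma_scheme \<Rightarrow> ('b, 'n) magma_scheme \<Rightarrow> ('c, 'k) magma_scheme \<Rightarrow> bool" where
  "right_regular_triple A B C \<longleftrightarrow>
    carrier_semigroup A \<and> carrier_semigroup B \<and> carrier_semigroup C \<and>
    (\<exists>P \<in> carrier B \<rightarrow> carrier A. \<exists>P' \<in> carrier B \<rightarrow> carrier C.
      quotient_semigroup (rees_matrix A (carrier B) P) (theta (rees_matrix A (carrier B) P))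
        \<cong> rees_matrix C (carrier B) P')"

lemma rees_matrix_semigroup:
  assumes "carrier_semigroup S" and "\<Lambda> \<noteq> {}" and "P \<in> \<Lambda> \<rightarrow> carrier S"
  shows "carrier_semigroup (rees_matrix S \<Lambda> P)"
proof -
  interpret carrier_semigroup S by fact
  have P: "P l \<in> carrier S" if "l \<in> \<Lambda>" for l
    using assms(3) that by auto
  show ?thesis
    by unfold_locales
      (use carrier_nonempty assms(2) in \<open>auto simp: rees_matrix_def P mult_assoc\<close>)
qed

lemma theta_congruence:
  assumes "carrier_semigroup S"
  shows "is_congruence S (theta S)"
proof -
  interpret carrier_semigroup S by fact
  have "equiv (carrier S) (theta S)"
    by (rule equivI) (auto simp: theta_def refl_on_def sym_def trans_def)
  moreover have "(a \<odot>\<^bsub>S\<^esub> c, b \<odot>\<^bsub>S\<^esub> d) \<in> theta S"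
    if "(a, b) \<in> theta S" and "(c, d) \<in> theta S" for a b c d
  proof -
    have mem: "a \<in> carrier S" "b \<in> carrier S" "c \<in> carrier S" "d \<in> carrier S"
      using that by (auto simp: theta_def)
    have "x \<odot>\<^bsub>S\<^esub> (a \<odot>\<^bsub>S\<^esub> c) = x \<odot>\<^bsub>S\<^esub> (b \<odot>\<^bsub>S\<^esub> d)" if x: "x \<in> carrier S" for x
    proof -
      have "x \<odot>\<^bsub>S\<^esub> (a \<odot>\<^bsub>S\<^esub> c) = (x \<odot>\<^bsub>S\<^esub> a) \<odot>\<^bsub>S\<^esub> c"
        using mem x by (simp add: mult_assoc)
      also have "\<dots> = (x \<odot>\<^bsub>S\<^esub> a) \<odot>\<^bsub>S\<^esub> d"
        using \<open>(c, d) \<in> theta S\<close> mem x by (auto simp: theta_def)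
      also have "\<dots> = (x \<odot>\<^bsub>S\<^esub> b) \<odot>\<^bsub>S\<^esub> d"
        using \<open>(a, b) \<in> theta S\<close> x by (auto simp: theta_def)
      also have "\<dots> = x \<odot>\<^bsub>S\<^esub> (b \<odot>\<^bsub>S\<^esub> d)"
        using mem x by (simp add: mult_assoc)
      finally show ?thesis .
    qed
    with mem show ?thesis by (auto simp: theta_def)
  qed
  ultimately show ?thesis by (auto simp: is_congruence_def)
qed

lemma quotient_semigroup_mult:
  assumes "is_congruence S r" and "a \<in> carrier S" and "b \<in> carrier S"
  shows "r `` {a} \<odot>\<^bsub>quotient_semigroup S r\<^esub> r `` {b} = r `` {a \<odot>\<^bsub>S\<^esub> b}"
proof -
  have eq: "equiv (carrier S) r" using assms(1) by (simp add: is_congruence_def)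
  have const: "r `` {x \<odot>\<^bsub>S\<^esub> y} = r `` {a \<odot>\<^bsub>S\<^esub> b}"
    if "x \<in> r `` {a}" and "y \<in> r `` {b}" for x y
  proof -
    have "(a \<odot>\<^bsub>S\<^esub> b, x \<odot>\<^bsub>S\<^esub> y) \<in> r"
      using assms(1) that by (auto simp: is_congruence_def)
    then show ?thesis by (simp add: equiv_class_eq[OF eq])
  qed
  have ne: "r `` {a} \<noteq> {}" "r `` {b} \<noteq> {}"
    using equiv_class_self[OF eq] assms(2,3) by blast+
  have "(\<Union>x\<in>r `` {a}. \<Union>y\<in>r `` {b}. r `` {x \<odot>\<^bsub>S\<^esub> y}) =
      (\<Union>x\<in>r `` {a}. \<Union>y\<in>r `` {b}. r `` {a \<odot>\<^bsub>S\<^esub> b})"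
    by (intro SUP_cong refl const)
  also have "\<dots> = r `` {a \<odot>\<^bsub>S\<^esub> b}"
    by (simp only: ne UN_constant if_False)
  finally show ?thesis by (simp add: quotient_semigroup_def)
qed

lemma quotient_semigroup_semigroup:
  assumes "carrier_semigroup S" and "is_congruence S r"
  shows "carrier_semigroup (quotient_semigroup S r)"
proof -
  interpret carrier_semigroup S by fact
  let ?Q = "quotient_semigroup S r"
  have car: "carrier ?Q = carrier S // r"
    by (simp add: quotient_semigroup_def)
  note qmult = quotient_semigroup_mult[OF assms(2)]
  show ?thesis
  proof
    show "carrier ?Q \<noteq> {}"
      using carrier_nonempty by (simp add: car)
  next
    fix X Y assume "X \<in> carrier ?Q" and "Y \<in> carrier ?Q"
    then obtain a b where "a \<in> carrier S" "X = r `` {a}" "b \<in> carrier S" "Y = r `` {b}"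
      unfolding car by (elim quotientE)
    then show "X \<odot>\<^bsub>?Q\<^esub> Y \<in> carrier ?Q"
      by (simp add: qmult car quotientI)
  next
    fix X Y Z assume "X \<in> carrier ?Q" and "Y \<in> carrier ?Q" and "Z \<in> carrier ?Q"
    then obtain a b c where "a \<in> carrier S" "X = r `` {a}" "b \<in> carrier S" "Y = r `` {b}"
        "c \<in> carrier S" "Z = r `` {c}"
      unfolding car by (elim quotientE)
    then show "X \<odot>\<^bsub>?Q\<^esub> Y \<odot>\<^bsub>?Q\<^esub> Z = X \<odot>\<^bsub>?Q\<^esub> (Y \<odot>\<^bsub>?Q\<^esub> Z)"
      by (simp add: qmult mult_assoc)
  qed
qed

end

(* Right simplicity of A passes to the Rees matrix semigroup M(A;B;P), since
   (s, l) M(A;B;P) = s P(l) A x B, and from there along the surjection onto its quotient to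
   M(C;B;P'). It descends to C because R x B is a right ideal of M(C;B;P') for every right
   ideal R of C. *)

theory Submission
  imports Defs
begin

lemma quotient_map_hom:
  assumes "is_congruence S r"
  shows "(\<lambda>x. r `` {x}) \<in> semigroup_hom S (quotient_semigroup S r)"
  using assms
  by (auto simp: semigroup_hom_def quotient_semigroup_mult)
     (simp add: quotient_semigroup_def quotientI)

text \<open>Right ideals pull back along \<open>h\<close>: if \<open>h r\<close> lies in
  \<open>R\<close>, then so does \<open>h r\<close> times \<open>h s\<close>, which is the image of
  the product of \<open>r\<close> and \<open>s\<close>. Right simplicity of \<open>S\<close> makes
  the preimage everything, and surjectivity carries this over to \<open>T\<close>. The lemma serves
  both for the projection onto a quotient and for an isomorphism.\<close>

lemma right_simple_surj_hom:
  assumes "carrier_semigroup S" and "right_simple S"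
    and "h \<in> semigroup_hom S T" and "h ` carrier S = carrier T"
  shows "right_simple T"
  unfolding right_simple_def
proof (intro allI impI)
  fix R assume R: "right_ideal R T"
  interpret carrier_semigroup S by fact
  have sub: "R \<subseteq> carrier T" and ne: "R \<noteq> {}"
    and ideal: "\<And>r t. r \<in> R \<Longrightarrow> t \<in> carrier T \<Longrightarrow> r \<odot>\<^bsub>T\<^esub> t \<in> R"
    using R by (simp_all add: right_ideal_def)
  have hom: "h (x \<odot>\<^bsub>S\<^esub> y) = h x \<odot>\<^bsub>T\<^esub> h y" if "x \<in> carrier S" "y \<in> carrier S" for x y
    using assms(3) that by (simp add: semigroup_hom_def)
  have closed: "h x \<in> carrier T" if "x \<in> carrier S" for x
    unfolding assms(4)[symmetric] using that by (rule imageI)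
  \<comment> \<open>Surjectivity enters here for the first time: some element of \<open>R\<close>
    has a preimage.\<close>
  have "{x \<in> carrier S. h x \<in> R} \<noteq> {}"
    using sub ne unfolding assms(4)[symmetric] by blast
  then have "right_ideal {x \<in> carrier S. h x \<in> R} S"
    unfolding right_ideal_def
  proof (intro conjI ballI)
    fix r s assume "r \<in> {x \<in> carrier S. h x \<in> R}" and "s \<in> carrier S"
    then show "r \<odot>\<^bsub>S\<^esub> s \<in> {x \<in> carrier S. h x \<in> R}"
      by (simp add: hom closed ideal)
  qed auto
  then have "{x \<in> carrier S. h x \<in> R} = carrier S"
    using assms(2) unfolding right_simple_def by blast
  then have "carrier T \<subseteq> R"
    unfolding assms(4)[symmetric] by blast
  with sub show "R = carrier T"
    by (rule equalityI)
qed

lemma right_simple_quotient: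
  assumes "carrier_semigroup S" and "right_simple S" and "is_congruence S r"
  shows "right_simple (quotient_semigroup S r)"
proof (rule right_simple_surj_hom[OF assms(1,2) quotient_map_hom[OF assms(3)]])
  show "(\<lambda>x. r `` {x}) ` carrier S = carrier (quotient_semigroup S r)"
    by (auto simp: quotient_semigroup_def quotient_def)
qed

text \<open>By associativity (ax)s = a(xs), so the set aS is itself a right ideal. This turns right
  simplicity into solvability of ax = u.\<close>

lemma right_simple_mult_carrier:
  assumes "carrier_semigroup S" and "right_simple S" and "a \<in> carrier S"
  shows "(\<lambda>x. a \<odot>\<^bsub>S\<^esub> x) ` carrier S = carrier S"
proof -
  interpret carrier_semigroup S by fact
  have "right_ideal ((\<lambda>x. a \<odot>\<^bsub>S\<^esub> x) ` carrier S) S"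
    unfolding right_ideal_def
  proof (intro conjI ballI)
    fix r s assume "r \<in> (\<lambda>x. a \<odot>\<^bsub>S\<^esub> x) ` carrier S" and s: "s \<in> carrier S"
    then obtain x where x: "x \<in> carrier S" "r = a \<odot>\<^bsub>S\<^esub> x"
      by blast
    then have "r \<odot>\<^bsub>S\<^esub> s = a \<odot>\<^bsub>S\<^esub> (x \<odot>\<^bsub>S\<^esub> s)"
      using assms(3) s by (simp add: mult_assoc)
    then show "r \<odot>\<^bsub>S\<^esub> s \<in> (\<lambda>x. a \<odot>\<^bsub>S\<^esub> x) ` carrier S"
      using x(1) s by simp
  qed (use carrier_nonempty assms(3) in auto)
  then show ?thesis
    using assms(2) unfolding right_simple_def by blast
qed

lemma right_simple_rees_matrix:
  assumes "carrier_semigroup S" and "right_simple S" and "P \<in> \<Lambda> \<rightarrow> carrier S"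
  shows "right_simple (rees_matrix S \<Lambda> P)"
  unfolding right_simple_def
proof (intro allI impI)
  interpret carrier_semigroup S by fact
  let ?M = "rees_matrix S \<Lambda> P"
  fix R assume R: "right_ideal R ?M"
  then have sub: "R \<subseteq> carrier S \<times> \<Lambda>" and "R \<noteq> {}"
    by (simp_all add: right_ideal_def rees_matrix_def)
  then obtain s l where sl: "(s, l) \<in> R" "s \<in> carrier S" "l \<in> \<Lambda>"
    by blast
  have "(u, m) \<in> R" if "u \<in> carrier S" "m \<in> \<Lambda>" for u m
  proof -
    have "s \<odot>\<^bsub>S\<^esub> P l \<in> carrier S"
      using sl assms(3) by auto
    \<comment> \<open>Solve s P(l) t = u for \<open>t\<close>. A product takes its second coordinate
      from the right factor, so \<open>m\<close> can be prescribed freely and (s, l)(t, m) = (u,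
      m).\<close>
    from right_simple_mult_carrier[OF assms(1,2) this] that(1)
    obtain t where t: "t \<in> carrier S" "u = s \<odot>\<^bsub>S\<^esub> P l \<odot>\<^bsub>S\<^esub> t"
      by blast
    have "(t, m) \<in> carrier ?M"
      using t(1) that(2) by (simp add: rees_matrix_def)
    then have "(s, l) \<odot>\<^bsub>?M\<^esub> (t, m) \<in> R"
      using R sl(1) unfolding right_ideal_def by blast
    then show ?thesis
      by (simp add: rees_matrix_def t(2))
  qed
  with sub show "R = carrier ?M"
    by (auto simp: rees_matrix_def)
qed

text \<open>The first coordinate of (r, l)(t, m) is r P(l) t, which stays in a right ideal
  containing \<open>r\<close> whatever the value of P(l) is; the second coordinate is
  unrestricted.\<close>

lemma right_simple_of_rees_matrix:
  assumes "carrier_semigroup S" and "\<Lambda> \<noteq> {}" and "P \<in> \<Lambda> \<rightarrow> carrier S"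
    and "right_simple (rees_matrix S \<Lambda> P)"
  shows "right_simple S"
  unfolding right_simple_def
proof (intro allI impI)
  interpret carrier_semigroup S by fact
  fix R assume R: "right_ideal R S"
  have "right_ideal (R \<times> \<Lambda>) (rees_matrix S \<Lambda> P)"
    using R assms(2,3) by (auto simp: right_ideal_def rees_matrix_def Pi_iff)
  then have "R \<times> \<Lambda> = carrier S \<times> \<Lambda>"
    using assms(4) unfolding right_simple_def by (auto simp: rees_matrix_def)
  \<comment> \<open>The common factor \<open>\<Lambda>\<close> cancels because it is
    nonempty.\<close>
  then show "R = carrier S"
    using assms(2) by (auto simp: times_eq_iff)
qed

theorem theorem1:
  fixes A :: "'a magma" and B :: "'b magma" and C :: "'c magma"
  assumes "right_regular_triple A B C"
    and "right_simple A"
  shows "right_simple C"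
proof -
  obtain P P' h where A: "carrier_semigroup A" and B: "carrier_semigroup B"
    and C: "carrier_semigroup C"
    and P: "P \<in> carrier B \<rightarrow> carrier A" and P': "P' \<in> carrier B \<rightarrow> carrier C"
    and h: "h \<in> semigroup_hom
        (quotient_semigroup (rees_matrix A (carrier B) P) (theta (rees_matrix A (carrier B) P)))
        (rees_matrix C (carrier B) P')"
      "bij_betw h (carrier (quotient_semigroup (rees_matrix A (carrier B) P)
          (theta (rees_matrix A (carrier B) P))))
        (carrier (rees_matrix C (carrier B) P'))"
    using assms(1) unfolding right_regular_triple_def semigroup_iso_def by blast
  let ?M = "rees_matrix A (carrier B) P"
  have ne: "carrier B \<noteq> {}"
    by (rule carrier_semigroup.carrier_nonempty[OF B])
  note M = rees_matrix_semigroup[OF A ne P]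
  note cong = theta_congruence[OF M]
  have "right_simple (quotient_semigroup ?M (theta ?M))"
    by (rule right_simple_quotient[OF M right_simple_rees_matrix[OF A assms(2) P] cong])
  \<comment> \<open>Of the isomorphism \<open>h\<close> only its being a surjective homomorphism out
    of the quotient is used.\<close>
  then have "right_simple (rees_matrix C (carrier B) P')"
    by (rule right_simple_surj_hom[OF quotient_semigroup_semigroup[OF M cong] _ h(1)
          bij_betw_imp_surj_on[OF h(2)]])
  then show ?thesis
    by (rule right_simple_of_rees_matrix[OF C ne P'])
qed

end
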